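(* There exist absolute constants $c_1, c_2, C > 0$ such that the following holds. Let $n, m \ge 1$ and $d \ge 0$ be integers, let $0 < \epsilon < 1/40$, and let $E: \left(\{0,1\}^n\right)^2 \times \{0,1\}^d \to \{0,1\}^m$ be an $\epsilon$-extracting merger. Then: (i) if $\epsilon \geq 2^{-c_1 m}$, then $d \geq \log_2 m + \log_2 \frac{1}{\epsilon} - C$; (ii) if $\epsilon < 2^{-c_1 m}$, then $d \geq c_2\, m$.
   Context: A pair $(X,Y)$ of jointly distributed (possibly correlated) $\{0,1\}^n$-valued random variables is a (2-part) somewhere-random source if at least one of $X$, $Y$ is uniformly distributed over $\{0,1\}^n$. Here, a function $E: (\{0,1\}^n)^2 \times \{0,1\}^d \to \{0,1\}^m$ is called an $\epsilon$-extracting merger if for every 2-part somewhere-random source $(X,Y)$, and $J$ uniform on $\{0,1\}^d$ and independent of $(X,Y)$, the distribution of $E((X,Y),J)$ is $\epsilon$-close to the uniform distribution on $\{0,1\}^m$. Two distributions are $\epsilon$-close if their statistical (total variation) distance is at most $\epsilon$. *)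

theory Defs
  imports "HOL-Probability.Probability"
begin

definition cube :: "nat \<Rightarrow> bool list set" where
  "cube n = {xs. length xs = n}"

(* P is the joint distribution of the pair (X,Y); no independence is assumed. *)
definition somewhere_random :: "nat \<Rightarrow> (bool list \<times> bool list) pmf \<Rightarrow> bool" where
  "somewhere_random n P \<longleftrightarrow>
     set_pmf P \<subseteq> cube n \<times> cube n \<and>
     (map_pmf fst P = pmf_of_set (cube n) \<or> map_pmf snd P = pmf_of_set (cube n))"

(* The supremum ranges over a set of reals contained in [0,1]. *)
definition stat_dist :: "'a pmf \<Rightarrow> 'a pmf \<Rightarrow> real" where
  "stat_dist p q = (SUP A. \<bar>measure_pmf.prob p A - measure_pmf.prob q A\<bar>)"

(* Taking the product with pair_pmf makes the seed J independent of (X,Y). *)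
definition extracting_merger ::
  "nat \<Rightarrow> nat \<Rightarrow> nat \<Rightarrow> real \<Rightarrow> ((bool list \<times> bool list) \<times> bool list \<Rightarrow> bool list) \<Rightarrow> bool" where
  "extracting_merger n d m \<epsilon> E \<longleftrightarrow>
     E \<in> (cube n \<times> cube n) \<times> cube d \<rightarrow> cube m \<and>
     (\<forall>P. somewhere_random n P \<longrightarrow>
        stat_dist (map_pmf E (pair_pmf P (pmf_of_set (cube d)))) (pmf_of_set (cube m)) \<le> \<epsilon>)"

end

(* Fix x and let p_y be the law of E((x,y),J), whose support has at most D = 2^d points. Since the
   average of the p_y over y is \<epsilon>-close to uniform, one can choose greedily about \<epsilon> 2^m / D values of
   y such that all but 2\<epsilon> of the mass of each p_y lies outside the supports chosen before. For a
   uniformly random set T of outputs, the masses that T receives from these new parts are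
   independent, and each of them exceeds its mean by 3\<epsilon> or so with probability at least
   2^(-6\<epsilon>D-2): put the 6\<epsilon>D heaviest points into T and leave the rest to symmetry. If
   2^(6\<epsilon>D) is small compared with 2^m \<epsilon>^2 / D, then some p_y(T) is thus likely to exceed 1/2 by
   more than \<epsilon>, for every x. Choosing Y as a function of X that maximises p_Y(T) contradicts the
   merger property for some T, so m < 6\<epsilon>D + d + 2 log (1/\<epsilon>) + 3. Both bounds follow from this,
   except that part (ii) for small m needs d > 0. Without a seed, the first output bit would have a
   row that is constantly True (else Y could be chosen from X so as to make it always False), and
   then, for Y uniform, X constantly equal to the index of that row makes it always True. *)

theory Submission
  imports Defs
begin

section \<open>Sums over a random subset of a weighted set\<close>

text \<open>Discarding a lightest element never lowers the average weight, so one can shrink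
  \<open>S\<close> element by element. The inequality compares averages with the denominators
  cleared, which also covers \<open>k = 0\<close>.\<close>

lemma heavy_subset:
  fixes w :: "'a \<Rightarrow> real"
  assumes "finite S" "k \<le> card S"
  shows "\<exists>H\<subseteq>S. card H = k \<and> real k * sum w S \<le> real (card S) * sum w H"
  using assms(2)
proof (induction k rule: inc_induct)
  case base
  show ?case by blast
next
  case (step k)
  then obtain H where H: "H \<subseteq> S" "card H = Suc k"
      "real (Suc k) * sum w S \<le> real (card S) * sum w H" by blast
  have fin: "finite H" using H(1) assms(1) finite_subset by blast
  have "H \<noteq> {}" using H(2) by auto
  then obtain a where a: "a \<in> H" "\<And>b. b \<in> H \<Longrightarrow> w a \<le> w b"
    using fin by (metis arg_min_if_finite(1) arg_min_least)
  define H' where "H' = H - {a}"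
  have c: "card H' = k" using H(2) a(1) by (simp add: H'_def)
  have s: "sum w H = w a + sum w H'" using a(1) fin by (simp add: H'_def sum.remove)
  have "real k * w a \<le> sum w H'"
    using sum_bounded_below[of H' "w a" w] a(2) c by (auto simp: H'_def)
  then have "real k * sum w H \<le> real (Suc k) * sum w H'"
    unfolding s by (simp add: algebra_simps)
  then have 1: "real (card S) * (real k * sum w H) \<le> real (card S) * (real (Suc k) * sum w H')"
    by (intro mult_left_mono) auto
  have "real k * (real (Suc k) * sum w S) \<le> real k * (real (card S) * sum w H)"
    using H(3) by (intro mult_left_mono) auto
  also have "\<dots> = real (card S) * (real k * sum w H)" by (simp only: mult.left_commute)
  also note 1
  finally have "real (Suc k) * (real k * sum w S) \<le> real (Suc k) * (real (card S) * sum w H')"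
    by (simp only: mult.left_commute)
  then have "real k * sum w S \<le> real (card S) * sum w H'"
    by (rule mult_left_le_imp_le) simp
  then show ?case using c H(1) H'_def by blast
qed

lemma bij_betw_Compl_Pow: "bij_betw (\<lambda>R. S - R) (Pow S) (Pow S)"
  by (rule bij_betw_byWitness[where f' = "\<lambda>R. S - R"]) auto

text \<open>Of a subset and its complement at least one carries half of the total weight, so the
  complements of the heavy subsets cover all the others.\<close>

lemma half_of_subsets_heavy:
  fixes w :: "'a \<Rightarrow> real"
  assumes "finite S"
  shows "2 ^ card S \<le> 2 * card {R \<in> Pow S. sum w S / 2 \<le> sum w R}"
proof -
  let ?A = "{R \<in> Pow S. sum w S / 2 \<le> sum w R}"
  have "Pow S - ?A \<subseteq> (\<lambda>R. S - R) ` ?A"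
  proof
    fix R assume R: "R \<in> Pow S - ?A"
    then have "sum w (S - R) = sum w S - sum w R"
      using assms by (simp add: sum_diff)
    with R have "S - R \<in> ?A" by auto
    moreover have "R = S - (S - R)" using R by auto
    ultimately show "R \<in> (\<lambda>R. S - R) ` ?A" by blast
  qed
  then have "card (Pow S - ?A) \<le> card ?A"
    using assms by (intro surj_card_le) auto
  moreover have "card (Pow S) = card ?A + card (Pow S - ?A)"
    using assms card_mono[of "Pow S" ?A] by (simp add: card_Diff_subset Collect_mono_iff Pow_def)
  ultimately show ?thesis using assms by (simp add: card_Pow)
qed

lemma sum_card_Pow:
  assumes "finite U"
  shows "(\<Sum>T\<in>Pow U. real (card T)) = real (card U) * 2 ^ card U / 2"
proof -
  have "(\<Sum>T\<in>Pow U. real (card T)) = (\<Sum>T\<in>Pow U. real (card (U - T)))"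
    using sum.reindex_bij_betw[OF bij_betw_Compl_Pow[of U], of "\<lambda>T. real (card T)"] by simp
  also have "\<dots> = (\<Sum>T\<in>Pow U. real (card U) - real (card T))"
    using assms by (intro sum.cong refl) (auto simp: card_Diff_subset finite_subset card_mono of_nat_diff)
  also have "\<dots> = real (card U) * 2 ^ card U - (\<Sum>T\<in>Pow U. real (card T))"
    using assms by (simp add: sum_subtractf card_Pow)
  finally show ?thesis by simp
qed

text \<open>A random \<open>R\<close> contains a prescribed \<open>H\<close> of at most
  \<open>r\<close> elements with probability at least 2^(-r), and independently its part outside
  \<open>H\<close> gets half of the remaining weight with probability at least 1/2. Then
  \<open>R\<close> weighs at least half of \<open>sum w S + sum w H\<close>, and \<open>H\<close>
  can be chosen with a share of at least r/D of the total.\<close>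

lemma subset_sum_upper_tail:
  fixes w :: "'a \<Rightarrow> real"
  assumes "finite S" "\<And>a. a \<in> S \<Longrightarrow> 0 \<le> w a" "card S \<le> D" "r \<le> D"
  shows "2 ^ card S \<le>
    2 ^ Suc r * card {R \<in> Pow S. sum w S / 2 * (1 + real r / real D) \<le> sum w R}"
proof -
  let ?A = "{R \<in> Pow S. sum w S / 2 * (1 + real r / real D) \<le> sum w R}"
  have W: "0 \<le> sum w S" using assms(2) by (rule sum_nonneg)
  define k where "k = min r (card S)"
  obtain H where H: "H \<subseteq> S" "card H = k" "real k * sum w S \<le> real (card S) * sum w H"
    using heavy_subset[OF assms(1), of k w] by (auto simp: k_def)
  have wH: "0 \<le> sum w H" using assms(2) H(1) by (intro sum_nonneg) auto
  have heavy: "sum w S * (real r / real D) \<le> sum w H"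
  proof (cases "r \<le> card S")
    case True
    have "real r * sum w S \<le> real (card S) * sum w H" using H(3) True by (simp add: k_def)
    also have "\<dots> \<le> real D * sum w H" using assms(3) wH by (intro mult_right_mono) auto
    \<comment> \<open>For \<open>D = 0\<close> the quotient \<open>real r / real D\<close> is 0 and
      only \<open>0 \<le> sum w H\<close> remains.\<close>
    finally show ?thesis using wH by (cases "D = 0") (auto simp: field_simps)
  next
    case False
    then have "H = S" using H assms(1) by (metis card_subset_eq k_def min.absorb2 nat_le_linear)
    moreover have "real r / real D \<le> 1" using assms(4) by (simp add: divide_le_eq)
    ultimately show ?thesis using mult_left_le[OF _ W] by blast
  qed
  let ?B = "{R \<in> Pow (S - H). sum w (S - H) / 2 \<le> sum w R}"
  have "inj_on (\<lambda>R. H \<union> R) ?B" by (auto simp: inj_on_def)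
  moreover have "(\<lambda>R. H \<union> R) ` ?B \<subseteq> ?A"
  proof
    fix Q assume "Q \<in> (\<lambda>R. H \<union> R) ` ?B"
    then obtain R where R: "R \<subseteq> S - H" "sum w (S - H) / 2 \<le> sum w R" and Q: "Q = H \<union> R" by auto
    have f: "finite H" "finite R" using assms(1) H(1) R(1) by (auto intro: finite_subset)
    have "sum w Q = sum w H + sum w R"
      unfolding Q using f R(1) by (intro sum.union_disjoint) auto
    moreover have "sum w (S - H) = sum w S - sum w H" using assms(1) H(1) f by (simp add: sum_diff)
    ultimately have "sum w S / 2 * (1 + real r / real D) \<le> sum w Q"
      using R(2) heavy by (simp add: algebra_simps)
    then show "Q \<in> ?A" using Q R(1) H(1) by auto
  qed
  moreover have "finite ?A" using assms(1) by simp
  ultimately have "card ?B \<le> card ?A" by (metis (no_types, lifting) card_image card_mono)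
  have "(2::nat) ^ card S = 2 ^ k * 2 ^ card (S - H)"
    using H assms(1) card_mono[OF assms(1) H(1)]
    by (simp add: card_Diff_subset finite_subset flip: power_add)
  also have "\<dots> \<le> 2 ^ k * (2 * card ?B)"
    using half_of_subsets_heavy[of "S - H" w] assms(1) by simp
  also have "\<dots> \<le> 2 ^ r * (2 * card ?A)"
    using \<open>card ?B \<le> card ?A\<close> by (intro mult_le_mono) (auto simp: k_def)
  finally show ?thesis by simp
qed

text \<open>The traces of a uniformly random subset of \<open>U\<close> on disjoint blocks are
  independent, so the probabilities multiply. In counting form, \<open>T\<close> is split into its
  trace on the last block and the rest.\<close>

lemma card_subsets_avoiding:
  fixes S :: "nat \<Rightarrow> 'a set" and q :: real
  assumes "finite U" "\<And>i. i < K \<Longrightarrow> S i \<subseteq> U"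
    "\<And>i j. i < j \<Longrightarrow> j < K \<Longrightarrow> S i \<inter> S j = {}"
    "\<And>i. i < K \<Longrightarrow> real (card {R \<in> Pow (S i). Q i R}) \<le> q * 2 ^ card (S i)"
    "0 \<le> q"
  shows "real (card {T \<in> Pow U. \<forall>i<K. Q i (T \<inter> S i)}) \<le> q ^ K * 2 ^ card U"
  using assms
\<comment> \<open>\<open>U\<close> varies because the earlier blocks are treated inside
  \<open>U - S K\<close>.\<close>
proof (induction K arbitrary: U)
  case 0
  then show ?case by (simp add: card_Pow flip: Pow_def)
next
  case (Suc K)
  let ?V = "U - S K"
  let ?A = "{T \<in> Pow U. \<forall>i<Suc K. Q i (T \<inter> S i)}"
  let ?B = "{T \<in> Pow ?V. \<forall>i<K. Q i (T \<inter> S i)}"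
  let ?C = "{R \<in> Pow (S K). Q K R}"
  have SU: "S K \<subseteq> U" using Suc.prems(2) by simp
  have fS: "finite (S K)" using SU Suc.prems(1) finite_subset by blast
  have IH: "real (card ?B) \<le> q ^ K * 2 ^ card ?V"
  proof (rule Suc.IH)
    fix i assume i: "i < K"
    then have "S i \<inter> S K = {}" using Suc.prems(3) by simp
    then show "S i \<subseteq> U - S K" using Suc.prems(2)[of i] i by auto
  qed (use Suc.prems in auto)
  let ?f = "\<lambda>T. (T - S K, T \<inter> S K)"
  have "inj_on ?f ?A" by (auto simp: inj_on_def)
  moreover have "?f ` ?A \<subseteq> ?B \<times> ?C"
  proof (rule image_subsetI)
    fix T assume T: "T \<in> ?A"
    have "(T - S K) \<inter> S i = T \<inter> S i" if "i < K" for i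
      using Suc.prems(3)[of i K] that by auto
    then show "(T - S K, T \<inter> S K) \<in> ?B \<times> ?C" using T by auto
  qed
  moreover have "finite (?B \<times> ?C)" using fS Suc.prems(1) by simp
  ultimately have "card ?A \<le> card (?B \<times> ?C)" by (rule card_inj_on_le)
  then have "real (card ?A) \<le> real (card ?B) * real (card ?C)"
    by (simp only: card_cartesian_product flip: of_nat_mult)
  also have "\<dots> \<le> (q ^ K * 2 ^ card ?V) * (q * 2 ^ card (S K))"
    using IH Suc.prems(4)[of K] Suc.prems(5) by (intro mult_mono) auto
  also have "\<dots> = q ^ Suc K * 2 ^ (card ?V + card (S K))" by (simp add: power_add)
  also have "card ?V + card (S K) = card U"
    using SU fS Suc.prems(1) card_mono[OF Suc.prems(1) SU] by (simp add: card_Diff_subset)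
  finally show ?case .
qed

text \<open>Combines 1 - p \<le> exp (-p) with x \<le> exp x. This crude bound already makes the
  probability that \<open>K\<close> independent trials all fail at most \<epsilon> once p K \<ge>
  1/\<epsilon>.\<close>

lemma one_minus_power_le:
  fixes p :: real
  assumes "0 < p" "p \<le> 1" "0 < K"
  shows "(1 - p) ^ K \<le> 1 / (p * real K)"
proof -
  have "(1 - p) ^ K \<le> exp (- p) ^ K" 
    using assms exp_ge_add_one_self[of "-p"] by (intro power_mono) auto
  also have "\<dots> = 1 / exp (p * real K)"
    by (simp add: exp_minus inverse_eq_divide power_divide flip: exp_of_nat2_mult)
  also have "\<dots> \<le> 1 / (p * real K)"
  proof (rule frac_le)
    show "p * real K \<le> exp (p * real K)" using exp_ge_add_one_self[of "p * real K"] by linarith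
  qed (use assms in auto)
  finally show ?thesis .
qed

section \<open>Maximising the probability of a random event over a family of distributions\<close>

text \<open>Greedy choice: the supports chosen so far cover at most an \<epsilon> fraction of
  \<open>U\<close>, so their mass averaged over \<open>Y\<close> is at most 2\<epsilon>, and some
  \<open>y\<close> does not exceed the average.\<close>

lemma pmfs_with_mostly_new_support:
  fixes p :: "'y \<Rightarrow> 'z pmf" and \<epsilon> :: real
  assumes "finite Y" "Y \<noteq> {}" "finite U" "U \<noteq> {}"
    and supp: "\<And>y. y \<in> Y \<Longrightarrow> set_pmf (p y) \<subseteq> U" "\<And>y. y \<in> Y \<Longrightarrow> card (set_pmf (p y)) \<le> D"
    and avg: "\<And>B. B \<subseteq> U \<Longrightarrow>
      (\<Sum>y\<in>Y. measure_pmf.prob (p y) B) / card Y \<le> card B / card U + \<epsilon>"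
    and K: "real K * real D \<le> \<epsilon> * card U"
  shows "\<exists>y. \<forall>i<K. y i \<in> Y \<and>
    measure_pmf.prob (p (y i)) (\<Union>k<i. set_pmf (p (y k))) \<le> 2 * \<epsilon>"
proof -
  \<comment> \<open>The choice principle yields an infinite sequence; the guard \<open>i < K\<close>
    lets the values from \<open>K\<close> on be arbitrary.\<close>
  define P where "P f i r \<longleftrightarrow> (i < K \<longrightarrow> r \<in> Y \<and>
    measure_pmf.prob (p r) (\<Union>k<i. set_pmf (p (f k))) \<le> 2 * \<epsilon>)" for f and i :: nat and r
  have "\<exists>y. \<forall>i. P y i (y i)"
  proof (rule dependent_wellorder_choice)
    fix r :: 'y and f g :: "nat \<Rightarrow> 'y" and i :: nat
    assume "\<And>k. k < i \<Longrightarrow> f k = g k"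
    then have "(\<Union>k<i. set_pmf (p (f k))) = (\<Union>k<i. set_pmf (p (g k)))" by auto
    then show "P f i r = P g i r" by (simp add: P_def)
  next
    fix i :: nat and f :: "nat \<Rightarrow> 'y"
    assume IH: "\<And>k. k < i \<Longrightarrow> P f k (f k)"
    show "\<exists>r. P f i r"
    proof (cases "i < K")
      case True
      then have fY: "f k \<in> Y" if "k < i" for k using IH[OF that] that by (simp add: P_def)
      define B where "B = (\<Union>k<i. set_pmf (p (f k)))"
      have B: "B \<subseteq> U" using fY supp(1) by (fastforce simp: B_def)
      have "card B \<le> (\<Sum>k<i. card (set_pmf (p (f k))))" unfolding B_def by (rule card_UN_le) simp
      also have "\<dots> \<le> (\<Sum>k<i. D)" using fY supp(2) by (intro sum_mono) auto
      also have "\<dots> \<le> K * D" using True by simp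
      finally have "real (card B) \<le> \<epsilon> * card U" using K by (smt (verit) of_nat_le_iff of_nat_mult)
      then have "card B / card U \<le> \<epsilon>" using assms(3,4) by (simp add: divide_le_eq card_gt_0_iff)
      then have "(\<Sum>y\<in>Y. measure_pmf.prob (p y) B) / card Y \<le> 2 * \<epsilon>" using avg[OF B] by linarith
      then have "(\<Sum>y\<in>Y. measure_pmf.prob (p y) B) \<le> (\<Sum>y\<in>Y. 2 * \<epsilon>)"
        using assms(1,2) by (simp add: divide_le_eq card_gt_0_iff mult_ac)
      then obtain y where "y \<in> Y" "measure_pmf.prob (p y) B \<le> 2 * \<epsilon>"
        using sum_strict_mono[OF assms(1,2), of "\<lambda>_. 2 * \<epsilon>" "\<lambda>y. measure_pmf.prob (p y) B"] by force
      then show ?thesis by (auto simp: P_def B_def)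
    qed (simp add: P_def)
  qed
  then show ?thesis by (auto simp: P_def)
qed

text \<open>Divided by \<open>2 ^ card U\<close>, the sum is the expected mass that a random
  \<open>T\<close> receives when the distribution may depend on \<open>T\<close>. Unless all
  \<open>K\<close> independent trials fail, some distribution gives \<open>T\<close> mass at least
  \<theta>, so the expectation is at least \<theta> (1 - \<epsilon>).\<close>

lemma expected_max_prob_gt:
  fixes p :: "'y \<Rightarrow> 'z pmf" and \<epsilon> :: real
  assumes "finite Y" "Y \<noteq> {}" "finite U" "U \<noteq> {}"
    and supp: "\<And>y. y \<in> Y \<Longrightarrow> set_pmf (p y) \<subseteq> U" "\<And>y. y \<in> Y \<Longrightarrow> card (set_pmf (p y)) \<le> D"
    and avg: "\<And>B. B \<subseteq> U \<Longrightarrow>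
      (\<Sum>y\<in>Y. measure_pmf.prob (p y) B) / card Y \<le> card B / card U + \<epsilon>"
    and K: "real K * real D \<le> \<epsilon> * card U" "2 ^ Suc r \<le> \<epsilon> * real K"
    and \<epsilon>: "0 < \<epsilon>" "\<epsilon> < 1 / 40"
    and r: "r \<le> D" "6 * \<epsilon> * real D \<le> real r" "0 < D"
  shows "\<exists>g. (\<forall>T. g T \<in> Y) \<and>
    (1 / 2 + \<epsilon>) * 2 ^ card U < (\<Sum>T\<in>Pow U. measure_pmf.prob (p (g T)) T)"
proof -
  from pmfs_with_mostly_new_support[OF assms(1-7) K(1)]
  obtain y where "\<forall>i<K. y i \<in> Y \<and>
      measure_pmf.prob (p (y i)) (\<Union>k<i. set_pmf (p (y k))) \<le> 2 * \<epsilon>" ..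
  then have y: "y i \<in> Y"
    "measure_pmf.prob (p (y i)) (\<Union>k<i. set_pmf (p (y k))) \<le> 2 * \<epsilon>" if "i < K" for i
    using that by simp_all
  define S where "S i = set_pmf (p (y i)) - (\<Union>k<i. set_pmf (p (y k)))" for i
  define w where "w i = pmf (p (y i))" for i
  \<comment> \<open>The new part \<open>S i\<close> has mass at least 1 - 2\<epsilon>, half of which
    is its mean contribution; the last factor is the gain from the upper tail.\<close>
  define \<theta> where "\<theta> = (1 - 2 * \<epsilon>) / 2 * (1 + real r / real D)"
  define Q where "Q i R \<longleftrightarrow> \<not> sum (w i) (S i) / 2 * (1 + real r / real D) \<le> sum (w i) R" for i R
  define Bad where "Bad = {T \<in> Pow U. \<forall>i<K. Q i (T \<inter> S i)}"
  have S: "S i \<subseteq> U" "card (S i) \<le> D" "finite (S i)" if "i < K" for i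
  proof -
    show "S i \<subseteq> U" using supp(1) y(1)[OF that] by (auto simp: S_def)
    have "finite (set_pmf (p (y i)))" using supp(1) y(1)[OF that] assms(3) finite_subset by blast
    then show "card (S i) \<le> D" "finite (S i)"
      using supp(2)[OF y(1)[OF that]] card_mono[of "set_pmf (p (y i))" "S i"] by (auto simp: S_def)
  qed
  have W: "1 - 2 * \<epsilon> \<le> sum (w i) (S i)" if "i < K" for i
  proof -
    let ?B = "\<Union>k<i. set_pmf (p (y k))"
    have "1 = measure_pmf.prob (p (y i)) (S i \<union> ?B)"
      by (rule sym, subst measure_pmf.prob_eq_1) (auto simp: S_def AE_measure_pmf_iff)
    also have "\<dots> \<le> measure_pmf.prob (p (y i)) (S i) + measure_pmf.prob (p (y i)) ?B"
      by (rule measure_Un_le) auto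
    also have "measure_pmf.prob (p (y i)) (S i) = sum (w i) (S i)"
      using S(3)[OF that] by (simp add: measure_measure_pmf_finite w_def)
    finally show ?thesis using y(2)[OF that] by simp
  qed
  define t where "t = 1 / (2::real) ^ Suc r"
  have "(1::real) \<le> 2 ^ Suc r" by (rule one_le_power) simp
  then have t: "0 < t" "t \<le> 1" unfolding t_def by simp_all
  have "0 < K" using \<open>(1::real) \<le> 2 ^ Suc r\<close> K(2) by (intro gr0I) auto
  have "real (card Bad) \<le> (1 - t) ^ K * 2 ^ card U"
    unfolding Bad_def
  proof (rule card_subsets_avoiding[OF assms(3)])
    fix i assume i: "i < K"
    show "S i \<subseteq> U" using S(1)[OF i] .
    let ?A = "{R \<in> Pow (S i). sum (w i) (S i) / 2 * (1 + real r / real D) \<le> sum (w i) R}"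
    have "2 ^ card (S i) \<le> 2 ^ Suc r * card ?A"
      using subset_sum_upper_tail[OF S(3)[OF i] _ S(2)[OF i] r(1)] by (simp add: w_def)
    then have "real (2 ^ card (S i)) \<le> real (2 ^ Suc r * card ?A)" by (rule of_nat_mono)
    then have "2 ^ card (S i) * t \<le> real (card ?A)"
      by (simp add: t_def divide_le_eq mult_ac)
    moreover have "{R \<in> Pow (S i). Q i R} = Pow (S i) - ?A" by (auto simp: Q_def)
    moreover have "card (Pow (S i) - ?A) = card (Pow (S i)) - card ?A"
      using S(3)[OF i] by (intro card_Diff_subset) auto
    moreover have "card ?A \<le> card (Pow (S i))" using S(3)[OF i] by (intro card_mono) auto
    ultimately show "real (card {R \<in> Pow (S i). Q i R}) \<le> (1 - t) * 2 ^ card (S i)"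
      using S(3)[OF i] by (simp add: of_nat_diff card_Pow algebra_simps)
  next
    fix i j assume "i < j" "j < K"
    then show "S i \<inter> S j = {}" by (auto simp: S_def)
  qed (use t in auto)
  also have "(1 - t) ^ K \<le> 1 / (t * real K)" using one_minus_power_le[OF t \<open>0 < K\<close>] .
  also have "\<dots> \<le> \<epsilon>" using K(2) \<open>0 < K\<close> by (simp add: t_def divide_le_eq)
  finally have bad: "real (card Bad) \<le> \<epsilon> * 2 ^ card U" by simp
  \<comment> \<open>The implication sits inside the existential so that the choice function takes
    values in \<open>Y\<close> on bad sets too.\<close>
  have good: "\<exists>v\<in>Y. T \<in> Pow U - Bad \<longrightarrow> \<theta> \<le> measure_pmf.prob (p v) T" for T
  proof (cases "T \<in> Pow U - Bad")
    case True
    then obtain i where i: "i < K" "\<not> Q i (T \<inter> S i)" by (auto simp: Bad_def)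
    have "\<theta> \<le> sum (w i) (S i) / 2 * (1 + real r / real D)"
      unfolding \<theta>_def using W[OF i(1)] by (intro mult_right_mono divide_right_mono) auto
    also have "\<dots> \<le> sum (w i) (T \<inter> S i)" using i(2) by (simp add: Q_def)
    also have "\<dots> = measure_pmf.prob (p (y i)) (T \<inter> S i)"
      using S(3)[OF i(1)] by (simp add: measure_measure_pmf_finite w_def)
    also have "\<dots> \<le> measure_pmf.prob (p (y i)) T" by (rule measure_pmf.finite_measure_mono) auto
    finally show ?thesis using y(1)[OF i(1)] by blast
  qed (use assms(2) in auto)
  then have "\<exists>g. \<forall>T. g T \<in> Y \<and> (T \<in> Pow U - Bad \<longrightarrow> \<theta> \<le> measure_pmf.prob (p (g T)) T)"
    by (intro choice) blast
  then obtain g where g: "\<And>T. g T \<in> Y" "\<And>T. T \<in> Pow U - Bad \<Longrightarrow> \<theta> \<le> measure_pmf.prob (p (g T)) T"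
    by blast
  have "6 * \<epsilon> \<le> real r / real D" using r by (simp add: le_divide_eq)
  then have "(1 - 2 * \<epsilon>) / 2 * (1 + 6 * \<epsilon>) \<le> \<theta>"
    unfolding \<theta>_def using \<epsilon> by (intro mult_left_mono) auto
  then have "(1 - 2 * \<epsilon>) / 2 * (1 + 6 * \<epsilon>) * (1 - \<epsilon>) \<le> \<theta> * (1 - \<epsilon>)"
    using \<epsilon> by (intro mult_right_mono) auto
  \<comment> \<open>To first order, the tail gains 3\<epsilon>, the old supports cost \<epsilon> and
    the bad sets cost \<epsilon>/2, which leaves more than \<epsilon>. Twice the exact difference of
    the two sides is the product shown positive below.\<close>
  moreover have "1 / 2 + \<epsilon> < (1 - 2 * \<epsilon>) / 2 * (1 + 6 * \<epsilon>) * (1 - \<epsilon>)"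
  proof -
    have "0 < \<epsilon> * (1 - 16 * \<epsilon> + 12 * \<epsilon> * \<epsilon>)" using \<epsilon> by (intro mult_pos_pos add_pos_nonneg) auto
    then show ?thesis by (simp add: algebra_simps)
  qed
  ultimately have "(1 / 2 + \<epsilon>) * 2 ^ card U < \<theta> * (1 - \<epsilon>) * 2 ^ card U" by simp
  also have "\<dots> = \<theta> * (2 ^ card U - \<epsilon> * 2 ^ card U)" by (simp add: algebra_simps)
  also have "\<dots> \<le> \<theta> * real (card (Pow U - Bad))"
  proof (rule mult_left_mono)
    have "Bad \<subseteq> Pow U" "finite Bad" using assms(3) by (auto simp: Bad_def)
    then show "2 ^ card U - \<epsilon> * 2 ^ card U \<le> real (card (Pow U - Bad))"
      using bad assms(3) card_mono[of "Pow U" Bad]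
      by (simp add: card_Diff_subset of_nat_diff card_Pow)
    show "0 \<le> \<theta>" using \<epsilon> by (simp add: \<theta>_def)
  qed
  also have "\<dots> \<le> (\<Sum>T\<in>Pow U - Bad. measure_pmf.prob (p (g T)) T)"
    using sum_mono[of "Pow U - Bad" "\<lambda>_. \<theta>" "\<lambda>T. measure_pmf.prob (p (g T)) T"] g(2) by (simp add: mult.commute)
  also have "\<dots> \<le> (\<Sum>T\<in>Pow U. measure_pmf.prob (p (g T)) T)"
    using assms(3) by (intro sum_mono2) auto
  finally show ?thesis using g(1) by blast
qed

section \<open>Mergers applied to sources generated by one uniform string\<close>

lemma prob_map_pair_pmf_of_set:
  fixes u :: "'a \<Rightarrow> 'b" and J :: "'c pmf" and E :: "'b \<times> 'c \<Rightarrow> 'd"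
  assumes "finite A" "A \<noteq> {}"
  shows "measure_pmf.prob (map_pmf E (pair_pmf (map_pmf u (pmf_of_set A)) J)) T =
    (\<Sum>a\<in>A. measure_pmf.prob (map_pmf (\<lambda>j. E (u a, j)) J) T) / card A"
proof -
  have "map_pmf E (pair_pmf (map_pmf u (pmf_of_set A)) J) =
      bind_pmf (pmf_of_set A) (\<lambda>a. map_pmf (\<lambda>j. E (u a, j)) J)"
    by (simp add: pair_pmf_def map_pmf_def bind_assoc_pmf bind_return_pmf)
  moreover have "measure_pmf.prob (bind_pmf p f) T = (\<integral>a. measure_pmf.prob (f a) T \<partial>p)" for p and f :: "'a \<Rightarrow> 'd pmf"
    unfolding measure_pmf_bind
    by (rule measure_pmf.measure_bind[where N = "count_space UNIV"])
      (auto simp: measure_pmf_in_subprob_algebra)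
  ultimately show ?thesis
    using assms by (simp add: integral_pmf_of_set)
qed

lemma finite_cube [simp]: "finite (cube n)"
  and card_cube [simp]: "card (cube n) = 2 ^ n"
  and cube_nonempty [simp]: "cube n \<noteq> {}"
proof -
  have *: "cube n = {xs. set xs \<subseteq> UNIV \<and> length xs = n}" by (simp add: cube_def)
  show "finite (cube n)" unfolding * by (rule finite_lists_length_eq) simp
  show "card (cube n) = 2 ^ n" unfolding * by (subst card_lists_length_eq) simp_all
  then show "cube n \<noteq> {}" by (metis card.empty power_not_zero zero_neq_numeral)
qed

lemma abs_prob_diff_le_stat_dist:
  "\<bar>measure_pmf.prob p A - measure_pmf.prob q A\<bar> \<le> stat_dist p q"
  unfolding stat_dist_def
proof (rule cSUP_upper)
  show "bdd_above (range (\<lambda>A. \<bar>measure_pmf.prob p A - measure_pmf.prob q A\<bar>))"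
  proof (rule bdd_aboveI2)
    fix A show "\<bar>measure_pmf.prob p A - measure_pmf.prob q A\<bar> \<le> 1"
      using measure_pmf.prob_le_1[of p A] measure_pmf.prob_le_1[of q A]
        measure_nonneg[of p A] measure_nonneg[of q A] by linarith
  qed
qed simp

definition seeded where
  "seeded d E x y = map_pmf (\<lambda>j. E ((x, y), j)) (pmf_of_set (cube d))"

text \<open>All sources in the argument are images of one uniform string under a map
  \<open>u\<close> that keeps this string as one coordinate; the other coordinate may be constant or
  chosen adversarially. On them the merger property becomes an inequality between finite
  averages.\<close>

lemma extracting_merger_map:
  assumes "extracting_merger n d m \<epsilon> E"
    "u \<in> cube n \<rightarrow> cube n \<times> cube n"
    "(\<forall>x\<in>cube n. fst (u x) = x) \<or> (\<forall>x\<in>cube n. snd (u x) = x)"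
    "T \<subseteq> cube m"
  shows "\<bar>(\<Sum>x\<in>cube n. measure_pmf.prob (seeded d E (fst (u x)) (snd (u x))) T) / 2 ^ n
    - card T / 2 ^ m\<bar> \<le> \<epsilon>"
proof -
  let ?P = "map_pmf u (pmf_of_set (cube n))"
  have "map_pmf f (pmf_of_set (cube n)) = pmf_of_set (cube n)" if "\<forall>x\<in>cube n. f x = x" for f
  proof -
    have "map_pmf f (pmf_of_set (cube n)) = map_pmf (\<lambda>x. x) (pmf_of_set (cube n))"
      using that by (intro map_pmf_cong) auto
    then show ?thesis by simp
  qed
  then have "map_pmf fst ?P = pmf_of_set (cube n) \<or> map_pmf snd ?P = pmf_of_set (cube n)"
    using assms(3) by (auto simp: map_pmf_comp)
  moreover have "set_pmf ?P \<subseteq> cube n \<times> cube n"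
    using assms(2) by (simp add: image_subset_iff_funcset)
  ultimately have "somewhere_random n ?P" by (simp add: somewhere_random_def)
  then have "stat_dist (map_pmf E (pair_pmf ?P (pmf_of_set (cube d)))) (pmf_of_set (cube m)) \<le> \<epsilon>"
    using assms(1) by (auto simp: extracting_merger_def)
  then have "\<bar>measure_pmf.prob (map_pmf E (pair_pmf ?P (pmf_of_set (cube d)))) T
      - measure_pmf.prob (pmf_of_set (cube m)) T\<bar> \<le> \<epsilon>"
    using abs_prob_diff_le_stat_dist order_trans by blast
  moreover have "cube m \<inter> T = T" using assms(4) by auto
  ultimately show ?thesis
    by (simp only: prob_map_pair_pmf_of_set[OF finite_cube cube_nonempty] seeded_def
        measure_pmf_of_set[OF cube_nonempty finite_cube] card_cube prod.collapse
        of_nat_power of_nat_numeral)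
qed

lemma set_pmf_seeded:
  assumes "extracting_merger n d m \<epsilon> E" "x \<in> cube n" "y \<in> cube n"
  shows "set_pmf (seeded d E x y) \<subseteq> cube m" "card (set_pmf (seeded d E x y)) \<le> 2 ^ d"
proof -
  have *: "set_pmf (seeded d E x y) = (\<lambda>j. E ((x, y), j)) ` cube d"
    by (simp add: seeded_def)
  show "set_pmf (seeded d E x y) \<subseteq> cube m"
    using assms unfolding * extracting_merger_def by auto
  show "card (set_pmf (seeded d E x y)) \<le> 2 ^ d"
    unfolding * by (metis card_cube card_image_le finite_cube)
qed

section \<open>Bounding the output length\<close>

text \<open>Two kinds of sources are used. A fixed \<open>x\<close> with uniform \<open>y\<close>
  supplies the averaging hypothesis of \<open>expected_max_prob_gt\<close>, and the resulting choice
  \<open>g x T\<close> gives, for each \<open>T\<close>, the source \<open>(x, g x T)\<close> with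
  \<open>x\<close> uniform. Averaging over \<open>x\<close> and \<open>T\<close> shows that these
  cannot all be extracted well.\<close>

lemma extracting_merger_output_length_less:
  assumes E: "extracting_merger n d m \<epsilon> E" and \<epsilon>: "0 < \<epsilon>" "\<epsilon> < 1 / 40"
  shows "real m < 6 * \<epsilon> * 2 ^ d + 3 + real d + 2 * log 2 (1 / \<epsilon>)"
proof (rule ccontr)
  assume m: "\<not> ?thesis"
  define r where "r = nat \<lceil>6 * \<epsilon> * 2 ^ d\<rceil>"
  define K where "K = nat \<lceil>2 ^ Suc r / \<epsilon>\<rceil>"
  have r: "6 * \<epsilon> * 2 ^ d \<le> real r" "real r < 6 * \<epsilon> * 2 ^ d + 1"
    unfolding r_def using \<epsilon> by (auto simp: of_nat_ceiling) linarith
  have "6 * \<epsilon> * 2 ^ d \<le> 1 * 2 ^ d" using \<epsilon> by (intro mult_right_mono) auto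
  then have rD: "r \<le> 2 ^ d" by (simp add: r_def nat_le_iff ceiling_le_iff)
  have "(1::real) \<le> 2 ^ Suc r" by (rule one_le_power) simp
  then have "1 \<le> 2 ^ Suc r / \<epsilon>" using \<epsilon> by (simp add: le_divide_eq)
  moreover have K1: "2 ^ Suc r / \<epsilon> \<le> real K" unfolding K_def by (rule of_nat_ceiling)
  moreover have "real K < 2 ^ Suc r / \<epsilon> + 1" unfolding K_def using \<epsilon> by simp linarith
  \<comment> \<open>The rounding error 1 is at most \<open>2 ^ Suc r / \<epsilon>\<close>, so
    rounding at most doubles the bound.\<close>
  ultimately have K2: "real K \<le> 2 ^ (r + 2) / \<epsilon>" by simp
  \<comment> \<open>The constant 3 in the claim pays 2 for the exponent in \<open>K2\<close> and 1
    for rounding up \<open>r\<close>.\<close>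
  have "real (r + 2 + d) \<le> real m + 2 * log 2 \<epsilon>"
    using m r(2) \<epsilon> by (simp add: log_divide)
  then have "2 powr real (r + 2 + d) \<le> 2 powr (real m + 2 * log 2 \<epsilon>)" by simp
  also have "\<dots> = 2 ^ m * \<epsilon> ^ 2"
  proof -
    have "2 powr (2 * log 2 \<epsilon>) = (2 powr log 2 \<epsilon>) powr 2" by (simp add: powr_powr mult.commute)
    then show ?thesis using \<epsilon> by (simp add: powr_add powr_realpow)
  qed
  finally have "2 ^ (r + 2 + d) \<le> 2 ^ m * \<epsilon> ^ 2" by (simp only: powr_realpow)
  then have "2 ^ (r + 2) / \<epsilon> * 2 ^ d \<le> \<epsilon> * 2 ^ m"
    using \<epsilon> by (simp add: power_add divide_le_eq power2_eq_square mult_ac)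
  moreover have "real K * 2 ^ d \<le> 2 ^ (r + 2) / \<epsilon> * 2 ^ d" using K2 by (intro mult_right_mono) auto
  ultimately have K3: "real K * 2 ^ d \<le> \<epsilon> * 2 ^ m" by linarith
  have "\<exists>g. (\<forall>T. g T \<in> cube n) \<and> (1 / 2 + \<epsilon>) * 2 ^ card (cube m)
      < (\<Sum>T\<in>Pow (cube m). measure_pmf.prob (seeded d E x (g T)) T)" if x: "x \<in> cube n" for x
  proof (rule expected_max_prob_gt[where p = "seeded d E x" and Y = "cube n" and U = "cube m"])
    show "set_pmf (seeded d E x y) \<subseteq> cube m" "card (set_pmf (seeded d E x y)) \<le> 2 ^ d"
      if "y \<in> cube n" for y using set_pmf_seeded[OF E x that] .
    show "(\<Sum>y\<in>cube n. measure_pmf.prob (seeded d E x y) B) / card (cube n)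
        \<le> card B / card (cube m) + \<epsilon>" if "B \<subseteq> cube m" for B
      using extracting_merger_map[OF E _ _ that, of "\<lambda>y. (x, y)"] x by simp
    show "real K * real (2 ^ d) \<le> \<epsilon> * card (cube m)" using K3 by simp
    show "2 ^ Suc r \<le> \<epsilon> * real K" using K1 \<epsilon> by (simp add: divide_le_eq mult.commute)
    show "6 * \<epsilon> * real (2 ^ d) \<le> real r" using r(1) by simp
  qed (use \<epsilon> rD in auto)
  then have "\<exists>g. \<forall>x\<in>cube n. (\<forall>T. g x T \<in> cube n) \<and> (1 / 2 + \<epsilon>) * 2 ^ card (cube m)
      < (\<Sum>T\<in>Pow (cube m). measure_pmf.prob (seeded d E x (g x T)) T)"
    by (intro bchoice ballI)
  then obtain g where g: "\<And>x T. x \<in> cube n \<Longrightarrow> g x T \<in> cube n"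
    "\<And>x. x \<in> cube n \<Longrightarrow> (1 / 2 + \<epsilon>) * 2 ^ card (cube m)
      < (\<Sum>T\<in>Pow (cube m). measure_pmf.prob (seeded d E x (g x T)) T)"
    by blast
  have "2 ^ n * ((1 / 2 + \<epsilon>) * 2 ^ card (cube m)) = (\<Sum>x\<in>cube n. (1 / 2 + \<epsilon>) * 2 ^ card (cube m))"
    by simp
  also have "\<dots> < (\<Sum>x\<in>cube n. \<Sum>T\<in>Pow (cube m). measure_pmf.prob (seeded d E x (g x T)) T)"
    using g(2) by (intro sum_strict_mono) auto
  \<comment> \<open>For fixed \<open>T\<close>, the inner sum now belongs to a single source, to
    which the merger property applies.\<close>
  also have "\<dots> = (\<Sum>T\<in>Pow (cube m). \<Sum>x\<in>cube n. measure_pmf.prob (seeded d E x (g x T)) T)"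
    by (rule sum.swap)
  also have "\<dots> \<le> (\<Sum>T\<in>Pow (cube m). 2 ^ n * (card T / 2 ^ m + \<epsilon>))"
  proof (rule sum_mono)
    fix T assume "T \<in> Pow (cube m)"
    then have "(\<Sum>x\<in>cube n. measure_pmf.prob (seeded d E x (g x T)) T) / 2 ^ n \<le> card T / 2 ^ m + \<epsilon>"
      using extracting_merger_map[OF E, of "\<lambda>x. (x, g x T)" T] g(1) by auto
    then show "(\<Sum>x\<in>cube n. measure_pmf.prob (seeded d E x (g x T)) T) \<le> 2 ^ n * (card T / 2 ^ m + \<epsilon>)"
      by (simp add: divide_le_eq mult.commute)
  qed
  also have "\<dots> = 2 ^ n * ((\<Sum>T\<in>Pow (cube m). real (card T)) / 2 ^ m + \<epsilon> * 2 ^ card (cube m))"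
    unfolding sum_distrib_left[symmetric] sum.distrib sum_divide_distrib by (simp add: card_Pow)
  also have "\<dots> = 2 ^ n * ((1 / 2 + \<epsilon>) * 2 ^ card (cube m))"
    by (simp add: sum_card_Pow algebra_simps)
  finally show False by simp
qed

lemma extracting_merger_mono:
  assumes "extracting_merger n d m \<epsilon> E" "\<epsilon> \<le> \<epsilon>'"
  shows "extracting_merger n d m \<epsilon>' E"
  using assms by (force simp: extracting_merger_def)

lemma seed_nonempty:
  assumes E: "extracting_merger n d m \<epsilon> E" and "\<epsilon> < 1 / 2" "1 \<le> m"
  shows "1 \<le> d"
proof (rule ccontr)
  assume "\<not> 1 \<le> d"
  then have "d = 0" by simp
  then have cube_d: "cube d = {[]}" by (simp add: cube_def)
  define T where "T = {z \<in> cube m. hd z}"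
  define f where "f x y \<longleftrightarrow> E ((x, y), []) \<in> T" for x y
  have T: "T \<subseteq> cube m" by (auto simp: T_def)
  have prob: "measure_pmf.prob (seeded d E x y) T = of_bool (f x y)" for x y
    by (simp add: seeded_def cube_d pmf_of_set_singleton f_def indicator_def)
  obtain k where k: "m = Suc k" using assms(3) by (cases m) auto
  have "T = (#) True ` cube k" by (auto simp: T_def cube_def k length_Suc_conv)
  then have cT: "card T / 2 ^ m = 1 / 2" by (simp add: card_image k)
  \<comment> \<open>\<open>T\<close> has density 1/2 and the error is below 1/2, so without a seed
    no such source can make the first output bit constant.\<close>
  have bias: "\<exists>x\<in>cube n. f (fst (u x)) (snd (u x)) = b"
    if u: "u \<in> cube n \<rightarrow> cube n \<times> cube n"
      "(\<forall>x\<in>cube n. fst (u x) = x) \<or> (\<forall>x\<in>cube n. snd (u x) = x)" for u b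
  proof (rule ccontr)
    assume "\<not> ?thesis"
    then have "(\<Sum>x\<in>cube n. measure_pmf.prob (seeded d E (fst (u x)) (snd (u x))) T)
        = (\<Sum>x\<in>cube n. of_bool (\<not> b))"
      unfolding prob by (intro sum.cong) auto
    then show False
      using extracting_merger_map[OF E u T] assms(2) cT by (cases b) auto
  qed
  have row: "\<exists>x\<in>cube n. \<forall>y\<in>cube n. f x y = b" for b
  proof (rule ccontr)
    assume "\<not> ?thesis"
    then obtain g where "\<forall>x\<in>cube n. g x \<in> cube n \<and> f x (g x) \<noteq> b" by metis
    then show False using bias[of "\<lambda>x. (x, g x)" b] by auto
  qed
  obtain x1 where x1: "x1 \<in> cube n" "\<forall>y\<in>cube n. f x1 y" using row[of True] by auto
  then show False using bias[of "\<lambda>y. (x1, y)" False] by auto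
qed

section \<open>From the output length to the seed length\<close>

lemma log2_le_linear:
  assumes "1 \<le> x"
  shows "log 2 x \<le> x / 8 + 4"
proof -
  have log16: "log 2 (x / 16) = log 2 x - 4"
  proof -
    have "log 2 (16::real) = 4" using log_pow_cancel[of "2::real" 4] by simp
    then show ?thesis using assms by (simp add: log_divide)
  qed
  show ?thesis
  \<comment> \<open>Replacing \<open>ln 2\<close> by 1/2 in the denominator requires
    \<open>ln (x / 16)\<close> to be nonnegative; up to 16 the constant 4 suffices.\<close>
  proof (cases "x \<le> 16")
    case True
    then have "log 2 (x / 16) \<le> 0" using assms by simp
    then show ?thesis using log16 assms by simp
  next
    case False
    have "log 2 (x / 16) \<le> ln (x / 16) / (1 / 2)"
      unfolding log_def using False ln2_ge_two_thirds by (intro divide_left_mono) auto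
    also have "\<dots> \<le> (x / 16 - 1) / (1 / 2)"
      using ln_le_minus_one[of "x / 16"] assms by (intro divide_right_mono) auto
    finally show ?thesis using log16 by simp
  qed
qed

text \<open>Both logarithms together are at most m/4 + 4, so a seed of length m/4 is long enough.
  For shorter seeds the linear terms absorb at most m/2 of the output length, and 6\<epsilon>2^d
  must account for the rest.\<close>

lemma seed_length_lower_bound:
  assumes E: "extracting_merger n d m \<epsilon> E" and \<epsilon>: "0 < \<epsilon>" "\<epsilon> < 1 / 40"
    and m: "1 \<le> m" "2 powr (- (1 / 8) * real m) \<le> \<epsilon>"
  shows "log 2 (real m) + log 2 (1 / \<epsilon>) - 10 \<le> real d"
proof -
  have "log 2 (2 powr (- (1 / 8) * real m)) \<le> log 2 \<epsilon>" using m(2) \<epsilon> by (subst log_le_cancel_iff) auto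
  then have L: "log 2 (1 / \<epsilon>) \<le> real m / 8" using \<epsilon> by (simp add: log_divide)
  have M: "log 2 (real m) \<le> real m / 8 + 4" using m(1) by (intro log2_le_linear) simp
  show ?thesis
  \<comment> \<open>From 12 on, m/2 - 3 \<ge> m/4; below 12 the constant 10 makes the left side
    negative.\<close>
  proof (cases "real m / 4 \<le> real d \<or> m < 12")
    case True
    then show ?thesis using L M by (auto; linarith)
  next
    case False
    then have "real m / 4 \<le> 6 * \<epsilon> * 2 ^ d"
      using extracting_merger_output_length_less[OF E \<epsilon>] L by linarith
    \<comment> \<open>Rounding 6 up to 8 turns the factor 4 * 8 into \<open>2 ^ 5\<close>.\<close>
    also have "\<dots> \<le> 8 * \<epsilon> * 2 ^ d" using \<epsilon> by (intro mult_right_mono) auto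
    finally have "real m / \<epsilon> \<le> 2 ^ (5 + d)" using \<epsilon> by (simp add: divide_le_eq power_add mult_ac)
    then have "log 2 (real m / \<epsilon>) \<le> log 2 (2 ^ (5 + d))"
      using m(1) \<epsilon> by (subst log_le_cancel_iff) auto
    also have "\<dots> = 5 + real d" by (subst log_pow_cancel) auto
    finally show ?thesis using m(1) \<epsilon> by (simp add: log_divide)
  qed
qed

text \<open>A merger with smaller error is also one at the threshold error 2^(-m/8), where the
  previous bound gives d \<ge> m/8 - 10. This is at least m/160 from m = 160 on; for smaller m it is
  enough that d \<ge> 1.\<close>

lemma seed_length_linear:
  assumes E: "extracting_merger n d m \<epsilon> E" and \<epsilon>: "0 < \<epsilon>" "\<epsilon> < 1 / 40"
    and m: "1 \<le> m" "\<epsilon> < 2 powr (- (1 / 8) * real m)"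
  shows "1 / 160 * real m \<le> real d"
proof (cases "m < 160")
  case True
  moreover have "1 \<le> d" using seed_nonempty[OF E _ m(1)] \<epsilon> by simp
  ultimately show ?thesis by simp
next
  case False
  let ?\<epsilon> = "2 powr (- (1 / 8) * real m)"
  have "?\<epsilon> \<le> 2 powr (- 6)" using False by (intro powr_mono) auto
  also have "\<dots> = (1::real) / 64" by (simp add: powr_minus_divide)
  finally have "log 2 (real m) + log 2 (1 / ?\<epsilon>) - 10 \<le> real d"
    using extracting_merger_mono[OF E, of ?\<epsilon>] m by (intro seed_length_lower_bound[of n d m]) auto
  moreover have "log 2 (1 / ?\<epsilon>) = real m / 8" by (simp add: log_divide)
  moreover have "0 \<le> log 2 (real m)" using m(1) by simp
  ultimately show ?thesis using False by linarith
qed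

theorem theorem4:
  "\<exists>c1 c2 C :: real. c1 > 0 \<and> c2 > 0 \<and> C > 0 \<and>
     (\<forall>(n::nat) (m::nat) (d::nat) (\<epsilon>::real) E.
        n \<ge> 1 \<and> m \<ge> 1 \<and> 0 < \<epsilon> \<and> \<epsilon> < 1/40 \<and> extracting_merger n d m \<epsilon> E \<longrightarrow>
          (\<epsilon> \<ge> 2 powr (- c1 * real m) \<longrightarrow> real d \<ge> log 2 (real m) + log 2 (1 / \<epsilon>) - C) \<and>
          (\<epsilon> < 2 powr (- c1 * real m) \<longrightarrow> real d \<ge> c2 * real m))"
  using seed_length_lower_bound seed_length_linear
  by (intro exI[of _ "1 / 8"] exI[of _ "1 / 160"] exI[of _ 10]) auto

end
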